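(* Let $s\ge1$ and let $b_i,a_{ij}$ ($i,j=1,\dots,s$) be real numbers satisfying $$b_ia_{ij}+b_ja_{ji}=b_ib_j,\qquad\forall\,i,j=1,\dots,s.$$ Let $\tau>0$ and suppose that $(U^n,Q^n)\in\mathbb{R}^N\times\mathbb{R}^N$, $n=0,1,2,\dots$, are generated by the scheme $$K_i^n=\mathcal J_h\Big(\kappa U^{ni}+bD_2U^{ni}+\frac\beta3\big(Q^{ni}+2(U^{ni})^2\big)\Big),\qquad L_i^n=2U^{ni}\cdot K_i^n,$$ $$U^{ni}=U^n+\tau\sum_{j=1}^sa_{ij}K_j^n,\qquad Q^{ni}=Q^n+\tau\sum_{j=1}^sa_{ij}L_j^n,\qquad i=1,\dots,s,$$ $$U^{n+1}=U^n+\tau\sum_{i=1}^sb_iK_i^n,\qquad Q^{n+1}=Q^n+\tau\sum_{i=1}^sb_iL_i^n,$$ with all stage vectors in $\mathbb{R}^N$. Then the scheme preserves the following discrete invariants for $n=0,1,2,\dots$: $$H_{1,1}^{n+1}=H_{1,1}^n,\qquad H_{1,1}^n=Q^n-(U^n)^2\in\mathbb{R}^N,$$ $$\mathcal E_h^{n+1}=\mathcal E_h^n,\qquad \mathcal E_h^n=\frac\kappa2\|U^n\|_h^2+\frac b2\langle D_2U^n,U^n\rangle_h+\frac\beta3\langle U^n,Q^n\rangle_h.$$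
   Context: $\kappa,b,\beta,\delta,\alpha$ are real constants with $\delta>0$, $\alpha>0$ (the constant $b$ is distinct from the Runge-Kutta weights $b_i$); $\Omega=[x_l,x_r]$ is a bounded interval. $N$ is an even positive integer, $h=(x_r-x_l)/N$, $\mu=2\pi/(x_r-x_l)$, grid points $x_j=jh$. For $0\le j\le N-1$ let $$l_j(x)=\frac1N\sum_{k=-N/2}^{N/2}\frac1{c_k}e^{\mathrm{i}k\mu(x-x_j)},\qquad c_k=1\text{ if }|k|<N/2,\quad c_k=2\text{ if }|k|=N/2,$$ and define the $N\times N$ (real) Fourier spectral differentiation matrices $D_r$ by $(D_r)_{j,k}=\frac{d^r l_k}{dx^r}(x_j)$, $0\le j,k\le N-1$. Put $\mathcal J_h=-(I-\delta D_2+\alpha D_4)^{-1}D_1$ with $I$ the identity matrix. $U\cdot V$ denotes the componentwise product of vectors and $U^2=U\cdot U$. $\langle U,V\rangle_h=h\sum_{j=0}^{N-1}u_jv_j$ and $\|U\|_h^2=\langle U,U\rangle_h$. (The scheme corresponds to the generalized Rosenau-type equation with nonlinearity exponent $p=2$.) *)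

theory Defs
  imports "HOL-Analysis.Derivative" "Jordan_Normal_Form.Gauss_Jordan_Elimination"
begin

unbundle no vec_syntax and no inner_syntax

definition mesh_width :: "real \<Rightarrow> real \<Rightarrow> nat \<Rightarrow> real" where
  "mesh_width xl xr N = (xr - xl) / real N"

definition freq :: "real \<Rightarrow> real \<Rightarrow> real" where
  "freq xl xr = 2 * pi / (xr - xl)"

definition grid_point :: "real \<Rightarrow> real \<Rightarrow> nat \<Rightarrow> nat \<Rightarrow> real" where
  "grid_point xl xr N j = real j * mesh_width xl xr N"

definition mode_weight :: "nat \<Rightarrow> int \<Rightarrow> real" where
  "mode_weight N k = (if \<bar>k\<bar> < int (N div 2) then 1 else 2)"

text \<open>The trigonometric cardinal function \<open>l\<^sub>j\<close>; \<open>N\<close> is meant to be even and positive.\<close>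

definition fourier_cardinal :: "real \<Rightarrow> real \<Rightarrow> nat \<Rightarrow> nat \<Rightarrow> real \<Rightarrow> complex" where
  "fourier_cardinal xl xr N j x =
     1 / of_nat N * (\<Sum>k = - int (N div 2)..int (N div 2).
       1 / of_real (mode_weight N k) *
       exp (\<i> * of_int k * of_real (freq xl xr) * of_real (x - grid_point xl xr N j)))"

text \<open>The modes \<open>k\<close> and \<open>-k\<close> are complex conjugates, so that \<open>l\<^sub>j\<close> is real valued;
  taking real parts in \<open>fourier_diff_mat\<close> below therefore only changes the type.\<close>

lemma fourier_cardinal_real:
  "complex_of_real (Re (fourier_cardinal xl xr N j x)) = fourier_cardinal xl xr N j x"
proof -
  let ?m = "int (N div 2)"
  let ?t = "\<lambda>k. 1 / of_real (mode_weight N k) *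
       exp (\<i> * of_int k * of_real (freq xl xr) * of_real (x - grid_point xl xr N j)) :: complex"
  have cnj_t: "cnj (?t k) = ?t (- k)" for k
    by (simp add: complex_eq_iff Re_exp Im_exp mode_weight_def)
  have "cnj (\<Sum>k = - ?m..?m. ?t k) = (\<Sum>k = - ?m..?m. ?t (- k))"
    by (simp only: cnj_sum cnj_t)
  also have "\<dots> = (\<Sum>k = - ?m..?m. ?t k)"
    by (rule sum.reindex_bij_witness[of _ uminus uminus]) auto
  finally have "cnj (fourier_cardinal xl xr N j x) = fourier_cardinal xl xr N j x"
    by (simp only: fourier_cardinal_def complex_cnj_mult complex_cnj_divide
        complex_cnj_one complex_cnj_of_nat)
  then show ?thesis
    by (metis Reals_cnj_iff of_real_Re)
qed

text \<open>The Fourier spectral differentiation matrix \<open>D\<^sub>r\<close>; rows are indexed by the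
  evaluation point, columns by the cardinal function, both starting at \<open>0\<close>.\<close>

definition fourier_diff_mat :: "real \<Rightarrow> real \<Rightarrow> nat \<Rightarrow> nat \<Rightarrow> real mat" where
  "fourier_diff_mat xl xr N r =
     mat N N (\<lambda>(j, k). (deriv ^^ r) (\<lambda>x. Re (fourier_cardinal xl xr N k x))
                        (grid_point xl xr N j))"

text \<open>For \<open>xl < xr\<close>, even \<open>N > 0\<close> and \<open>\<delta>, \<alpha> > 0\<close> the matrix being inverted is symmetric and
  positive definite, so that \<open>mat_inverse\<close> does not return \<open>None\<close>.\<close>

definition J_mat :: "real \<Rightarrow> real \<Rightarrow> nat \<Rightarrow> real \<Rightarrow> real \<Rightarrow> real mat" where
  "J_mat xl xr N \<delta> \<alpha> =
     - the (mat_inverse (1\<^sub>m N - \<delta> \<cdot>\<^sub>m fourier_diff_mat xl xr N 2 + \<alpha> \<cdot>\<^sub>m fourier_diff_mat xl xr N 4))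
       * fourier_diff_mat xl xr N 1"

definition cw_prod :: "real vec \<Rightarrow> real vec \<Rightarrow> real vec" (infixl "\<odot>" 70) where
  "U \<odot> V = vec (dim_vec U) (\<lambda>j. U $ j * V $ j)"

definition inner_h :: "real \<Rightarrow> nat \<Rightarrow> real vec \<Rightarrow> real vec \<Rightarrow> real" where
  "inner_h h N U V = h * (\<Sum>j<N. U $ j * V $ j)"

definition norm_h :: "real \<Rightarrow> nat \<Rightarrow> real vec \<Rightarrow> real" where
  "norm_h h N U = sqrt (inner_h h N U U)"

definition H11 :: "real vec \<Rightarrow> real vec \<Rightarrow> real vec" where
  "H11 U Q = Q - U \<odot> U"

definition energy_h ::
  "real \<Rightarrow> real \<Rightarrow> nat \<Rightarrow> real \<Rightarrow> real \<Rightarrow> real \<Rightarrow> real vec \<Rightarrow> real vec \<Rightarrow> real" where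
  "energy_h xl xr N \<kappa> b \<beta> U Q =
     (let h = mesh_width xl xr N in
        \<kappa> / 2 * (norm_h h N U)\<^sup>2
      + b / 2 * inner_h h N (fourier_diff_mat xl xr N 2 *\<^sub>v U) U
      + \<beta> / 3 * inner_h h N U Q)"

end

theory Submission
  imports Defs "Jordan_Normal_Form.Determinant"
begin

text \<open>
  Both invariants are quadratic in the pair \<open>(U, Q)\<close>, and a Runge-Kutta method whose coefficients
  satisfy \<open>b\<^sub>i a\<^sub>i\<^sub>j + b\<^sub>j a\<^sub>j\<^sub>i = b\<^sub>i b\<^sub>j\<close> treats products exactly as the Leibniz rule does: the
  increment of a product over one step is the weighted sum of its derivatives at the stages
  (\<open>symplectic_product_rule\<close>). Applied to single components, this rule reduces conservation to
  an identity at each stage.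

  For \<open>Q - U\<^sup>2\<close> the stage derivative is \<open>L\<^sub>i - 2 U\<^sub>i \<cdot> K\<^sub>i\<close>, which vanishes by the choice of
  \<open>L\<^sub>i\<close>. For the energy, the symmetry of \<open>D\<^sub>2\<close> and again the choice of \<open>L\<^sub>i\<close> turn the stage
  derivative into \<open>\<langle>g\<^sub>i, K\<^sub>i\<rangle>\<close>, where \<open>g\<^sub>i\<close> is the vector to which \<open>J\<close> is applied in
  \<open>K\<^sub>i = J g\<^sub>i\<close>. It vanishes because \<open>J\<close> is skew (\<open>J_mat_skew_form\<close>).

  Skewness of \<open>J = - A\<^sup>-\<^sup>1 D\<^sub>1\<close> with \<open>A = I - \<delta> D\<^sub>2 + \<alpha> D\<^sub>4\<close> rests on the structure of the
  differentiation matrices: they are circulant, so \<open>A\<close> commutes with \<open>D\<^sub>1\<close>; the parity of their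
  kernels makes \<open>D\<^sub>1\<close> skew and \<open>A\<close> symmetric; and \<open>D\<^sub>2 \<le> 0 \<le> D\<^sub>4\<close> as quadratic forms gives
  \<open>A \<ge> I\<close>, so that \<open>A\<close> is invertible. The product \<open>D\<^sub>1\<^sup>2\<close> differs from \<open>D\<^sub>2\<close> in the highest
  frequency; commutation is therefore obtained from the circulant form and not by writing
  \<open>A\<close> as a polynomial in \<open>D\<^sub>1\<close>.
\<close>

section \<open>Symplectic Runge-Kutta schemes and products\<close>

text \<open>Multiplying out, the terms of first order in \<open>\<tau>\<close> agree at once. Those of second order are
  \<open>\<Sum> w\<^sub>i w\<^sub>j k\<^sub>i l\<^sub>j\<close> on the left and, after exchanging the summation indices in one half,
  \<open>\<Sum> (w\<^sub>i a\<^sub>i\<^sub>j + w\<^sub>j a\<^sub>j\<^sub>i) k\<^sub>i l\<^sub>j\<close> on the right.\<close>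

lemma symplectic_product_rule:
  fixes u q \<tau> :: real and w k l :: "'i \<Rightarrow> real" and a :: "'i \<Rightarrow> 'i \<Rightarrow> real"
  assumes sympl: "\<And>i j. i \<in> I \<Longrightarrow> j \<in> I \<Longrightarrow> w i * a i j + w j * a j i = w i * w j"
  shows "(u + \<tau> * (\<Sum>i\<in>I. w i * k i)) * (q + \<tau> * (\<Sum>i\<in>I. w i * l i)) =
    u * q + \<tau> * (\<Sum>i\<in>I. w i * (k i * (q + \<tau> * (\<Sum>j\<in>I. a i j * l j))
                          + l i * (u + \<tau> * (\<Sum>j\<in>I. a i j * k j))))"
proof -
  have "(\<Sum>i\<in>I. w i * k i) * (\<Sum>j\<in>I. w j * l j)
      = (\<Sum>i\<in>I. \<Sum>j\<in>I. (w i * w j) * (k i * l j))"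
    by (simp add: sum_product algebra_simps)
  also have "\<dots> = (\<Sum>i\<in>I. \<Sum>j\<in>I. (w i * a i j + w j * a j i) * (k i * l j))"
    by (intro sum.cong refl) (simp add: sympl)
  also have "\<dots> = (\<Sum>i\<in>I. \<Sum>j\<in>I. w i * a i j * (k i * l j))
                + (\<Sum>i\<in>I. \<Sum>j\<in>I. w j * a j i * (k i * l j))"
    by (simp add: algebra_simps sum.distrib)
  also have "(\<Sum>i\<in>I. \<Sum>j\<in>I. w j * a j i * (k i * l j))
           = (\<Sum>i\<in>I. \<Sum>j\<in>I. w i * a i j * (k j * l i))"
    by (rule sum.swap)
  finally have cross: "(\<Sum>i\<in>I. w i * k i) * (\<Sum>j\<in>I. w j * l j)
      = (\<Sum>i\<in>I. w i * k i * (\<Sum>j\<in>I. a i j * l j)) + (\<Sum>i\<in>I. w i * l i * (\<Sum>j\<in>I. a i j * k j))"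
    by (simp add: sum_distrib_left algebra_simps)
  have "(\<Sum>i\<in>I. w i * (k i * (q + \<tau> * (\<Sum>j\<in>I. a i j * l j))
                      + l i * (u + \<tau> * (\<Sum>j\<in>I. a i j * k j))))
      = q * (\<Sum>i\<in>I. w i * k i) + u * (\<Sum>i\<in>I. w i * l i)
        + \<tau> * ((\<Sum>i\<in>I. w i * k i) * (\<Sum>j\<in>I. w j * l j))"
    unfolding cross by (simp add: sum.distrib sum_distrib_left algebra_simps)
  then show ?thesis
    by (simp add: algebra_simps)
qed

section \<open>Circulant matrices\<close>

definition circulant :: "nat \<Rightarrow> (int \<Rightarrow> real) \<Rightarrow> real mat" where
  "circulant N f = mat N N (\<lambda>(j, k). f (int j - int k))"

lemma circulant_carrier [simp]: "circulant N f \<in> carrier_mat N N"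
  by (simp add: circulant_def)

lemma circulant_index [simp]: "j < N \<Longrightarrow> k < N \<Longrightarrow> circulant N f $$ (j, k) = f (int j - int k)"
  by (simp add: circulant_def)

lemma circulant_dim [simp]: "dim_row (circulant N f) = N" "dim_col (circulant N f) = N"
  by (simp_all add: circulant_def)

lemma periodic_mod:
  fixes f :: "int \<Rightarrow> 'a"
  assumes "\<And>d. f (d + int N) = f d"
  shows "f (d mod int N) = f d"
proof -
  have nat_shift: "f (d + int m * int N) = f d" for d m
  proof (induction m)
    case (Suc m)
    have "d + int (Suc m) * int N = (d + int m * int N) + int N"
      by (simp add: algebra_simps)
    with Suc assms show ?case by metis
  qed simp
  have "f (d + c * int N) = f d" for d c
    using nat_shift[of d "nat c"] nat_shift[of "d + c * int N" "nat (- c)"]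
    by (cases "c \<ge> 0") auto
  from this[of "d mod int N" "d div int N"] show ?thesis
    by simp
qed

text \<open>A product of circulant matrices with periodic kernels is a cyclic convolution, and
  convolution is commutative: the reflection \<open>l \<mapsto> j + k - l\<close> modulo \<open>N\<close> exchanges the two
  factors.\<close>

lemma circulant_commute:
  assumes f: "\<And>d. f (d + int N) = f d" and g: "\<And>d. g (d + int N) = g d"
  shows "circulant N f * circulant N g = circulant N g * circulant N f"
proof (rule eq_matI)
  fix j k assume "j < dim_row (circulant N g * circulant N f)"
    and "k < dim_col (circulant N g * circulant N f)"
  then have j: "j < N" and k: "k < N" by simp_all
  define \<sigma> where "\<sigma> l = nat ((int j + int k - int l) mod int N)" for l
  have \<sigma>: "int (\<sigma> l) = (int j + int k - int l) mod int N" for l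
    using j by (simp add: \<sigma>_def)
  have less: "\<sigma> l < N" for l
    using j \<sigma>[of l] by (metis less_nat_zero_code of_nat_0_less_iff of_nat_less_iff
        pos_mod_bound neq0_conv)
  have invol: "\<sigma> (\<sigma> l) = l" if "l < N" for l
  proof -
    have "int (\<sigma> (\<sigma> l)) = int l mod int N"
      unfolding \<sigma> by (simp add: mod_diff_right_eq)
    with that show ?thesis by simp
  qed
  have f\<sigma>: "f (int j - int (\<sigma> l)) = f (int l - int k)" for l
    using periodic_mod[of f N, OF f, of "int j - int (\<sigma> l)"]
      periodic_mod[of f N, OF f, of "int l - int k"]
    by (simp add: \<sigma> mod_diff_right_eq)
  have g\<sigma>: "g (int (\<sigma> l) - int k) = g (int j - int l)" for l
    using periodic_mod[of g N, OF g, of "int (\<sigma> l) - int k"]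
      periodic_mod[of g N, OF g, of "int j - int l"]
    by (simp add: \<sigma> mod_diff_left_eq)
  have "(\<Sum>l<N. f (int j - int l) * g (int l - int k))
      = (\<Sum>l<N. f (int j - int (\<sigma> l)) * g (int (\<sigma> l) - int k))"
    by (rule sum.reindex_bij_witness[of _ \<sigma> \<sigma>]) (auto simp: less invol)
  also have "\<dots> = (\<Sum>l<N. g (int j - int l) * f (int l - int k))"
    by (simp add: f\<sigma> g\<sigma> mult.commute)
  finally show "(circulant N f * circulant N g) $$ (j, k)
      = (circulant N g * circulant N f) $$ (j, k)"
    using j k by (simp add: scalar_prod_def lessThan_atLeast0)
qed simp_all

section \<open>Fourier differentiation matrices\<close>

text \<open>The kernel comes from differentiating the cosine form of the cardinal functions. The
  phase \<open>r \<pi> / 2\<close> covers the four cases \<open>\<plusminus> cos\<close>, \<open>\<plusminus> sin\<close> of the \<open>r\<close>-th derivative by one formula,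
  and \<open>2 \<pi> k d / N\<close> is the phase \<open>k \<mu> (x\<^sub>j - x\<^sub>l)\<close> with \<open>d = j - l\<close>, since \<open>\<mu> h = 2 \<pi> / N\<close>.\<close>

definition diff_kernel :: "nat \<Rightarrow> real \<Rightarrow> nat \<Rightarrow> int \<Rightarrow> real" where
  "diff_kernel N \<mu> r d = 1 / real N * (\<Sum>k = - int (N div 2)..int (N div 2).
     (of_int k * \<mu>) ^ r / mode_weight N k
       * cos (2 * pi * of_int k * of_int d / real N + real r * pi / 2))"

lemma mode_weight_pos: "mode_weight N k > 0"
  by (simp add: mode_weight_def)

lemma mode_weight_uminus: "mode_weight N (- k) = mode_weight N k"
  by (simp add: mode_weight_def)

lemma Re_fourier_cardinal:
  "Re (fourier_cardinal xl xr N j x) =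
     1 / real N * (\<Sum>k = - int (N div 2)..int (N div 2).
       1 / mode_weight N k * cos (of_int k * freq xl xr * (x - grid_point xl xr N j)))"
proof -
  have "Re (1 / of_real (mode_weight N k) *
       exp (\<i> * of_int k * of_real (freq xl xr) * of_real (x - grid_point xl xr N j)))
     = 1 / mode_weight N k * cos (of_int k * freq xl xr * (x - grid_point xl xr N j))" for k
    by (simp add: Re_exp)
  moreover have "Re (1 / of_nat N * z) = 1 / real N * Re z" for z
    by (simp add: Re_divide_of_nat)
  ultimately show ?thesis
    unfolding fourier_cardinal_def by (simp only: Re_sum)
qed

lemma deriv_power_cos_sum:
  fixes w \<omega> :: "'i \<Rightarrow> real"
  shows "(deriv ^^ r) (\<lambda>x. c * (\<Sum>k\<in>S. w k * cos (\<omega> k * (x - y)))) =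
    (\<lambda>x. c * (\<Sum>k\<in>S. w k * \<omega> k ^ r * cos (\<omega> k * (x - y) + real r * pi / 2)))"
proof (induction r)
  case (Suc r)
  have shift: "cos (t + real (Suc r) * pi / 2) = - sin (t + real r * pi / 2)" for t
  proof -
    have "t + real (Suc r) * pi / 2 = (t + real r * pi / 2) + pi / 2"
      by (simp add: field_simps)
    then show ?thesis by (simp only: cos_add) simp
  qed
  have "((\<lambda>x. c * (\<Sum>k\<in>S. w k * \<omega> k ^ r * cos (\<omega> k * (x - y) + real r * pi / 2)))
     has_real_derivative
       c * (\<Sum>k\<in>S. w k * \<omega> k ^ Suc r * cos (\<omega> k * (x - y) + real (Suc r) * pi / 2))) (at x)" for x
    unfolding shift by (auto intro!: derivative_eq_intros sum.cong simp: mult_ac)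
  then show ?case
    by (simp only: funpow.simps comp_def Suc.IH) (intro ext DERIV_imp_deriv)
qed simp

lemma fourier_diff_mat_circulant:
  assumes "xl < xr" and "N > 0"
  shows "fourier_diff_mat xl xr N r = circulant N (diff_kernel N (freq xl xr) r)"
proof (rule eq_matI)
  fix j k assume "j < dim_row (circulant N (diff_kernel N (freq xl xr) r))"
    and "k < dim_col (circulant N (diff_kernel N (freq xl xr) r))"
  then have j: "j < N" and k: "k < N" by simp_all
  have phase: "of_int m * freq xl xr * (grid_point xl xr N j - grid_point xl xr N k)
      = 2 * pi * of_int m * of_int (int j - int k) / real N" for m
    using assms by (simp add: freq_def grid_point_def mesh_width_def field_simps)
  show "fourier_diff_mat xl xr N r $$ (j, k)
      = circulant N (diff_kernel N (freq xl xr) r) $$ (j, k)"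
    using j k
    by (simp add: fourier_diff_mat_def del: of_int_diff)
      (simp only: Re_fourier_cardinal deriv_power_cos_sum phase diff_kernel_def,
        simp only: mult_1_left times_divide_eq_left)
qed (simp_all add: fourier_diff_mat_def)

lemma diff_kernel_periodic:
  assumes "N > 0"
  shows "diff_kernel N \<mu> r (d + int N) = diff_kernel N \<mu> r d"
proof -
  have "cos (2 * pi * of_int k * of_int (d + int N) / real N + real r * pi / 2)
      = cos (2 * pi * of_int k * of_int d / real N + real r * pi / 2)" for k
  proof -
    have "2 * pi * of_int k * of_int (d + int N) / real N + real r * pi / 2
        = (2 * pi * of_int k * of_int d / real N + real r * pi / 2) + 2 * pi * of_int k"
      using assms by (simp add: field_simps)
    then show ?thesis
      by (simp only: cos_add sin_int_2pin cos_int_2pin) simp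
  qed
  then show ?thesis
    by (simp add: diff_kernel_def)
qed

text \<open>Reversing the frequency, \<open>k \<mapsto> - k\<close>, restores the argument of the cosine and leaves the
  sign of \<open>(k \<mu>)\<^sup>r\<close> as the only change.\<close>

lemma diff_kernel_uminus:
  "diff_kernel N \<mu> r (- d) = (- 1) ^ r * diff_kernel N \<mu> r d"
proof -
  let ?m = "int (N div 2)"
  let ?t = "\<lambda>d k. (of_int k * \<mu>) ^ r / mode_weight N k
       * cos (2 * pi * of_int k * of_int d / real N + real r * pi / 2)"
  have "(\<Sum>k = - ?m..?m. ?t (- d) k) = (\<Sum>k = - ?m..?m. ?t (- d) (- k))"
    by (rule sum.reindex_bij_witness[of _ uminus uminus]) auto
  also have "\<dots> = (\<Sum>k = - ?m..?m. (- 1) ^ r * ?t d k)"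
    by (intro sum.cong refl) (simp add: mode_weight_uminus power_minus[of "_ * _"])
  finally show ?thesis
    by (simp add: diff_kernel_def sum_distrib_left algebra_simps)
qed

lemma transpose_fourier_diff_mat:
  assumes "xl < xr" and "N > 0"
  shows "transpose_mat (fourier_diff_mat xl xr N r) = (- 1) ^ r \<cdot>\<^sub>m fourier_diff_mat xl xr N r"
  unfolding fourier_diff_mat_circulant[OF assms]
proof (rule eq_matI)
  fix j k assume "j < dim_row ((- 1) ^ r \<cdot>\<^sub>m circulant N (diff_kernel N (freq xl xr) r))"
    and "k < dim_col ((- 1) ^ r \<cdot>\<^sub>m circulant N (diff_kernel N (freq xl xr) r))"
  then show "transpose_mat (circulant N (diff_kernel N (freq xl xr) r)) $$ (j, k)
      = ((- 1) ^ r \<cdot>\<^sub>m circulant N (diff_kernel N (freq xl xr) r)) $$ (j, k)"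
    using diff_kernel_uminus[of N "freq xl xr" r "int j - int k"] by simp
qed simp_all

lemma scalar_prod_mat_vec:
  fixes A :: "real mat"
  assumes "A \<in> carrier_mat N N" and "v \<in> carrier_vec N"
  shows "w \<bullet> (A *\<^sub>v v) = (\<Sum>j<N. \<Sum>k<N. A $$ (j, k) * (w $ j * v $ k))"
  using assms by (simp add: scalar_prod_def lessThan_atLeast0 sum_distrib_left mult_ac)

text \<open>For even order the phase only contributes the sign \<open>(-1)\<^sup>q\<close>. By the addition theorem
  each frequency then gives a nonnegative multiple of
  \<open>(\<Sum> v\<^sub>j cos \<theta>\<^sub>j)\<^sup>2 + (\<Sum> v\<^sub>j sin \<theta>\<^sub>j)\<^sup>2\<close>, the squared modulus of a discrete Fourier
  coefficient of \<open>v\<close>.\<close>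

lemma fourier_diff_mat_even_definite:
  assumes "xl < xr" and "N > 0" and v: "v \<in> carrier_vec N"
  shows "(- 1) ^ q * (v \<bullet> (fourier_diff_mat xl xr N (2 * q) *\<^sub>v v)) \<ge> 0"
proof -
  let ?m = "int (N div 2)"
  define \<theta> where "\<theta> m j = 2 * pi * real_of_int m * real j / real N" for m j
  define c where "c m = (of_int m * freq xl xr) ^ (2 * q) / (real N * mode_weight N m)" for m
  have c: "c m \<ge> 0" for m
    using mode_weight_pos[of N m] by (simp add: c_def power_mult)
  have cosq: "cos (t + real (2 * q) * pi / 2) = (- 1) ^ q * cos t" for t
    by (simp add: cos_add mult.commute)
  have entry: "(- 1) ^ q * diff_kernel N (freq xl xr) (2 * q) (int j - int k)
      = (\<Sum>m = - ?m..?m. c m * (cos (\<theta> m j) * cos (\<theta> m k) + sin (\<theta> m j) * sin (\<theta> m k)))"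
    for j k
  proof -
    have angle: "2 * pi * of_int m * of_int (int j - int k) / real N = \<theta> m j - \<theta> m k" for m
      by (simp add: \<theta>_def right_diff_distrib diff_divide_distrib)
    show ?thesis
      unfolding diff_kernel_def cosq angle cos_diff sum_distrib_left c_def
      by (intro sum.cong refl) (simp add: power_mult_distrib[symmetric] mult_ac)
  qed
  have "(- 1) ^ q * (v \<bullet> (fourier_diff_mat xl xr N (2 * q) *\<^sub>v v))
      = (\<Sum>j<N. \<Sum>k<N. ((- 1) ^ q * diff_kernel N (freq xl xr) (2 * q) (int j - int k))
           * (v $ j * v $ k))"
    unfolding fourier_diff_mat_circulant[OF assms(1,2)]
    by (simp add: scalar_prod_mat_vec[OF _ v] sum_distrib_left mult_ac)
  also have "\<dots> = (\<Sum>j<N. \<Sum>k<N. \<Sum>m = - ?m..?m. c m *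
      ((v $ j * cos (\<theta> m j)) * (v $ k * cos (\<theta> m k)) + (v $ j * sin (\<theta> m j)) * (v $ k * sin (\<theta> m k))))"
    unfolding entry sum_distrib_right by (intro sum.cong refl) (simp add: algebra_simps)
  also have "\<dots> = (\<Sum>j<N. \<Sum>m = - ?m..?m. \<Sum>k<N. c m *
      ((v $ j * cos (\<theta> m j)) * (v $ k * cos (\<theta> m k)) + (v $ j * sin (\<theta> m j)) * (v $ k * sin (\<theta> m k))))"
    by (rule sum.cong[OF refl sum.swap])
  also have "\<dots> = (\<Sum>m = - ?m..?m. \<Sum>j<N. \<Sum>k<N. c m *
      ((v $ j * cos (\<theta> m j)) * (v $ k * cos (\<theta> m k)) + (v $ j * sin (\<theta> m j)) * (v $ k * sin (\<theta> m k))))"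
    by (rule sum.swap)
  also have "\<dots> = (\<Sum>m = - ?m..?m. c m *
      ((\<Sum>j<N. v $ j * cos (\<theta> m j))\<^sup>2 + (\<Sum>j<N. v $ j * sin (\<theta> m j))\<^sup>2))"
    unfolding power2_eq_square sum_product sum.distrib[symmetric] sum_distrib_left[of "c _"] by (rule refl)
  also have "\<dots> \<ge> 0"
    using c by (intro sum_nonneg mult_nonneg_nonneg) auto
  finally show ?thesis .
qed

section \<open>Skew symmetry of the discrete Hamiltonian operator\<close>

text \<open>With \<open>v = A y\<close> the inverse disappears: commutation gives \<open>B D v = D y\<close>, so the form is
  \<open>- (A y) \<bullet> (D y)\<close>. Moving \<open>A\<close> across, then \<open>D\<close>, shows that \<open>(A y) \<bullet> (D y)\<close> equals its own
  negative.\<close>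

lemma skew_form_of_commuting_inverse:
  fixes A B D :: "real mat"
  assumes A: "A \<in> carrier_mat N N" and B: "B \<in> carrier_mat N N" and D: "D \<in> carrier_mat N N"
    and AB: "A * B = 1\<^sub>m N" and BA: "B * A = 1\<^sub>m N"
    and symA: "transpose_mat A = A" and skewD: "transpose_mat D = - D"
    and comm: "A * D = D * A"
    and v: "v \<in> carrier_vec N"
  shows "v \<bullet> ((- B * D) *\<^sub>v v) = 0"
proof -
  define y where "y = B *\<^sub>v v"
  have y: "y \<in> carrier_vec N" unfolding y_def using B v by simp
  have vy: "v = A *\<^sub>v y"
    unfolding y_def using A B v AB by (simp flip: assoc_mult_mat_vec)
  have Dy: "D *\<^sub>v y \<in> carrier_vec N" and Ay: "A *\<^sub>v y \<in> carrier_vec N"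
    using A D y by simp_all
  have "D *\<^sub>v v = A *\<^sub>v (D *\<^sub>v y)"
    unfolding vy using A D y comm by (simp flip: assoc_mult_mat_vec)
  then have "B *\<^sub>v (D *\<^sub>v v) = D *\<^sub>v y"
    using A B Dy BA by (simp flip: assoc_mult_mat_vec)
  then have J: "(- B * D) *\<^sub>v v = - (D *\<^sub>v y)"
    using B D v by (simp add: assoc_mult_mat_vec[of _ N N _ N])
  have 1: "(A *\<^sub>v y) \<bullet> (D *\<^sub>v y) = y \<bullet> (A *\<^sub>v (D *\<^sub>v y))"
    using transpose_vec_mult_scalar[OF A Dy y] by (simp add: symA)
  have "y \<bullet> (A *\<^sub>v (D *\<^sub>v y)) = y \<bullet> (D *\<^sub>v (A *\<^sub>v y))"
    using A D y comm by (simp flip: assoc_mult_mat_vec)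
  also have "\<dots> = - ((D *\<^sub>v y) \<bullet> (A *\<^sub>v y))"
    using transpose_vec_mult_scalar[OF D Ay y] D y Ay A by (simp add: skewD)
  also have "\<dots> = - ((A *\<^sub>v y) \<bullet> (D *\<^sub>v y))"
    using comm_scalar_prod[OF Dy Ay] by simp
  finally have "(A *\<^sub>v y) \<bullet> (D *\<^sub>v y) = 0"
    using 1 by simp
  then show ?thesis
    unfolding J using v Dy
    by (metis add.inverse_neutral carrier_vecD scalar_prod_uminus_right vy)
qed

text \<open>The estimate \<open>w \<bullet> A w \<ge> w \<bullet> w\<close> guarantees that the inverse in the definition of
  \<open>J_mat\<close> exists; the rest is the structure of the circulant matrices.\<close>

lemma J_mat_skew_form:
  assumes pos: "\<delta> > 0" "\<alpha> > 0" and grid: "xl < xr" "N > 0" and v: "v \<in> carrier_vec N"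
  shows "v \<bullet> (J_mat xl xr N \<delta> \<alpha> *\<^sub>v v) = 0"
proof -
  let ?D = "fourier_diff_mat xl xr N"
  let ?k = "diff_kernel N (freq xl xr)"
  define A where "A = 1\<^sub>m N - \<delta> \<cdot>\<^sub>m ?D 2 + \<alpha> \<cdot>\<^sub>m ?D 4"
  \<comment> \<open>The identity is circulant: for indices below \<open>N\<close>, \<open>N dvd j - k\<close> means \<open>j = k\<close>.
    Divisibility, unlike \<open>d = 0\<close>, is periodic in \<open>d\<close>.\<close>
  define f where "f d = (if int N dvd d then 1 else 0) - \<delta> * ?k 2 d + \<alpha> * ?k 4 d" for d
  have D: "?D r \<in> carrier_mat N N" for r
    by (simp add: fourier_diff_mat_def)
  have A: "A \<in> carrier_mat N N"
    unfolding A_def using D by simp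
  have A_circ: "A = circulant N f"
  proof (rule eq_matI)
    fix j k assume "j < dim_row (circulant N f)" "k < dim_col (circulant N f)"
    then have jk: "j < N" "k < N" by simp_all
    then have "int N dvd int j - int k \<longleftrightarrow> j = k"
      by (metis mod_eq_dvd_iff mod_pos_pos_trivial of_nat_0_le_iff of_nat_eq_iff of_nat_less_iff)
    with jk show "A $$ (j, k) = circulant N f $$ (j, k)"
      by (simp add: A_def f_def fourier_diff_mat_circulant[OF grid])
  qed (use A in simp_all)
  have comm: "A * ?D 1 = ?D 1 * A"
    unfolding A_circ fourier_diff_mat_circulant[OF grid]
    by (rule circulant_commute) (simp_all add: f_def diff_kernel_periodic grid)
  have symA: "transpose_mat A = A"
  proof -
    have "f (- d) = f d" for d
      by (simp add: f_def diff_kernel_uminus)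
    then have f_even: "f (int k - int j) = f (int j - int k)" for j k
      by (metis minus_diff_eq)
    show ?thesis
      unfolding A_circ by (intro eq_matI) (simp_all add: f_even)
  qed
  have skewD: "transpose_mat (?D 1) = - ?D 1"
    unfolding transpose_fourier_diff_mat[OF grid] by (intro eq_matI) simp_all
  have posA: "w \<bullet> (A *\<^sub>v w) \<ge> w \<bullet> w" if w: "w \<in> carrier_vec N" for w
  proof -
    have entry: "A $$ (j, k) = 1\<^sub>m N $$ (j, k) - \<delta> * ?D 2 $$ (j, k) + \<alpha> * ?D 4 $$ (j, k)"
      if "j < N" "k < N" for j k
      using that D[of 2] D[of 4] by (simp add: A_def)
    have "w \<bullet> (A *\<^sub>v w) = (\<Sum>j<N. \<Sum>k<N. (1\<^sub>m N $$ (j, k) - \<delta> * ?D 2 $$ (j, k)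
        + \<alpha> * ?D 4 $$ (j, k)) * (w $ j * w $ k))"
      unfolding scalar_prod_mat_vec[OF A w] by (intro sum.cong refl) (simp add: entry)
    also have "\<dots> = w \<bullet> (1\<^sub>m N *\<^sub>v w) - \<delta> * (w \<bullet> (?D 2 *\<^sub>v w)) + \<alpha> * (w \<bullet> (?D 4 *\<^sub>v w))"
      unfolding scalar_prod_mat_vec[OF D w] scalar_prod_mat_vec[OF one_carrier_mat w]
      by (simp add: distrib_right left_diff_distrib sum.distrib sum_subtractf sum_distrib_left mult.assoc)
    finally have "w \<bullet> (A *\<^sub>v w) = w \<bullet> w - \<delta> * (w \<bullet> (?D 2 *\<^sub>v w)) + \<alpha> * (w \<bullet> (?D 4 *\<^sub>v w))"
      using w by simp
    moreover have "w \<bullet> (?D 2 *\<^sub>v w) \<le> 0"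
      using fourier_diff_mat_even_definite[OF grid w, of 1] by simp
    moreover have "w \<bullet> (?D 4 *\<^sub>v w) \<ge> 0"
      using fourier_diff_mat_even_definite[OF grid w, of 2] by simp
    ultimately show ?thesis
      using pos by (smt (verit) mult_nonneg_nonneg mult_nonneg_nonpos)
  qed
  have "det A \<noteq> 0"
  proof
    assume "det A = 0"
    then obtain w where w: "w \<in> carrier_vec N" "w \<noteq> 0\<^sub>v N" "A *\<^sub>v w = 0\<^sub>v N"
      using det_0_iff_vec_prod_zero[OF A] by blast
    then have "(\<Sum>j<N. (w $ j)\<^sup>2) \<le> 0"
      using posA[OF w(1)] by (simp add: scalar_prod_def power2_eq_square lessThan_atLeast0)
    then have "(\<Sum>j<N. (w $ j)\<^sup>2) = 0"
      by (intro antisym sum_nonneg) auto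
    then have "w = 0\<^sub>v N"
      using w(1) by (intro eq_vecI) (auto simp: sum_nonneg_eq_0_iff)
    with w(2) show False ..
  qed
  then have "A \<in> Units (ring_mat TYPE(real) N ())"
    by (rule det_non_zero_imp_unit[OF A])
  then obtain B where inv: "mat_inverse A = Some B"
    using mat_inverse(1)[OF A, where b = "()"] by (cases "mat_inverse A") auto
  have B: "A * B = 1\<^sub>m N" "B * A = 1\<^sub>m N" "B \<in> carrier_mat N N"
    using mat_inverse(2)[OF A inv] by auto
  have "J_mat xl xr N \<delta> \<alpha> = - B * ?D 1"
    unfolding J_mat_def A_def[symmetric] inv by simp
  then show ?thesis
    using skew_form_of_commuting_inverse[OF A B(3) D B(1,2) symA skewD comm v] by simp
qed

section \<open>Conservation by the scheme\<close>

lemma runge_kutta_update_index: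
  assumes "finite I" and "u \<in> carrier_vec N" and "\<And>i. i \<in> I \<Longrightarrow> k i \<in> carrier_vec N" and "p < N"
  shows "(u + \<tau> \<cdot>\<^sub>v finsum_vec TYPE(real) N (\<lambda>i. c i \<cdot>\<^sub>v k i) I) $ p
    = u $ p + \<tau> * (\<Sum>i\<in>I. c i * k i $ p)"
proof -
  have k: "(\<lambda>i. c i \<cdot>\<^sub>v k i) \<in> I \<rightarrow> carrier_vec N"
    using assms(3) by simp
  have "finsum_vec TYPE(real) N (\<lambda>i. c i \<cdot>\<^sub>v k i) I $ p = (\<Sum>i\<in>I. c i * k i $ p)"
    unfolding index_finsum_vec[OF assms(1,4) k]
    by (intro sum.cong refl) (simp add: assms(4) carrier_vecD[OF assms(3)])
  moreover have "finsum_vec TYPE(real) N (\<lambda>i. c i \<cdot>\<^sub>v k i) I \<in> carrier_vec N"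
    by (rule finsum_vec_closed[OF k])
  ultimately show ?thesis
    using assms(2,4) by simp
qed

text \<open>A linear image of the solution follows the same Runge-Kutta update with the images of the
  slopes; thus the product rule also applies to components of \<open>D\<^sub>2 U\<close>.\<close>

lemma runge_kutta_update_mat_vec:
  fixes A :: "real mat"
  assumes "finite I" and "u \<in> carrier_vec N" and "\<And>i. i \<in> I \<Longrightarrow> k i \<in> carrier_vec N" and "p < N"
    and A: "A \<in> carrier_mat N N"
  shows "(A *\<^sub>v (u + \<tau> \<cdot>\<^sub>v finsum_vec TYPE(real) N (\<lambda>i. c i \<cdot>\<^sub>v k i) I)) $ p
    = (A *\<^sub>v u) $ p + \<tau> * (\<Sum>i\<in>I. c i * (A *\<^sub>v k i) $ p)"
proof -
  have Av: "(A *\<^sub>v v) $ p = (\<Sum>q<N. A $$ (p, q) * v $ q)" if "v \<in> carrier_vec N" for v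
    using that A \<open>p < N\<close> by (simp add: scalar_prod_def lessThan_atLeast0)
  have closed: "u + \<tau> \<cdot>\<^sub>v finsum_vec TYPE(real) N (\<lambda>i. c i \<cdot>\<^sub>v k i) I \<in> carrier_vec N"
    using assms(2,3) finsum_vec_closed[of "\<lambda>i. c i \<cdot>\<^sub>v k i" I N] by auto
  have "(\<Sum>i\<in>I. c i * (A *\<^sub>v k i) $ p) = (\<Sum>i\<in>I. c i * (\<Sum>q<N. A $$ (p, q) * k i $ q))"
    by (intro sum.cong refl) (simp only: Av assms(3))
  also have "\<dots> = (\<Sum>q<N. A $$ (p, q) * (\<Sum>i\<in>I. c i * k i $ q))"
    unfolding sum_distrib_left by (subst sum.swap) (simp add: mult.left_commute)
  finally have "(\<Sum>i\<in>I. c i * (A *\<^sub>v k i) $ p)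
      = (\<Sum>q<N. A $$ (p, q) * (\<Sum>i\<in>I. c i * k i $ q))" .
  moreover have "(\<Sum>q<N. A $$ (p, q) * (u + \<tau> \<cdot>\<^sub>v finsum_vec TYPE(real) N (\<lambda>i. c i \<cdot>\<^sub>v k i) I) $ q)
      = (\<Sum>q<N. A $$ (p, q) * (u $ q + \<tau> * (\<Sum>i\<in>I. c i * k i $ q)))"
    by (intro sum.cong refl) (simp add: runge_kutta_update_index[OF assms(1,2,3)])
  ultimately show ?thesis
    unfolding Av[OF closed] Av[OF assms(2)]
    by (simp add: distrib_left sum.distrib sum_distrib_left mult.left_commute)
qed


theorem theorem2p7:
  fixes \<kappa> b \<beta> \<delta> \<alpha> xl xr \<tau> :: real
    and N s :: nat
    and a :: "nat \<Rightarrow> nat \<Rightarrow> real"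
    and bw :: "nat \<Rightarrow> real"
    and U Q :: "nat \<Rightarrow> real vec"
    and K L Us Qs :: "nat \<Rightarrow> nat \<Rightarrow> real vec"
  assumes "\<delta> > 0" and "\<alpha> > 0" and "xl < xr"
    and "even N" and "N > 0"
    and "s \<ge> 1"
    and "\<And>i j. i \<in> {1..s} \<Longrightarrow> j \<in> {1..s} \<Longrightarrow> bw i * a i j + bw j * a j i = bw i * bw j"
    and "\<tau> > 0"
    and "\<And>n. U n \<in> carrier_vec N" and "\<And>n. Q n \<in> carrier_vec N"
    and "\<And>n i. i \<in> {1..s} \<Longrightarrow> K n i \<in> carrier_vec N"
    and "\<And>n i. i \<in> {1..s} \<Longrightarrow> L n i \<in> carrier_vec N"
    and "\<And>n i. i \<in> {1..s} \<Longrightarrow> Us n i \<in> carrier_vec N"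
    and "\<And>n i. i \<in> {1..s} \<Longrightarrow> Qs n i \<in> carrier_vec N"
    and "\<And>n i. i \<in> {1..s} \<Longrightarrow>
           K n i = J_mat xl xr N \<delta> \<alpha> *\<^sub>v
             (\<kappa> \<cdot>\<^sub>v Us n i + b \<cdot>\<^sub>v (fourier_diff_mat xl xr N 2 *\<^sub>v Us n i)
              + (\<beta> / 3) \<cdot>\<^sub>v (Qs n i + 2 \<cdot>\<^sub>v (Us n i \<odot> Us n i)))"
    and "\<And>n i. i \<in> {1..s} \<Longrightarrow> L n i = 2 \<cdot>\<^sub>v (Us n i \<odot> K n i)"
    and "\<And>n i. i \<in> {1..s} \<Longrightarrow>
           Us n i = U n + \<tau> \<cdot>\<^sub>v finsum_vec TYPE(real) N (\<lambda>j. a i j \<cdot>\<^sub>v K n j) {1..s}"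
    and "\<And>n i. i \<in> {1..s} \<Longrightarrow>
           Qs n i = Q n + \<tau> \<cdot>\<^sub>v finsum_vec TYPE(real) N (\<lambda>j. a i j \<cdot>\<^sub>v L n j) {1..s}"
    and "\<And>n. U (Suc n) = U n + \<tau> \<cdot>\<^sub>v finsum_vec TYPE(real) N (\<lambda>i. bw i \<cdot>\<^sub>v K n i) {1..s}"
    and "\<And>n. Q (Suc n) = Q n + \<tau> \<cdot>\<^sub>v finsum_vec TYPE(real) N (\<lambda>i. bw i \<cdot>\<^sub>v L n i) {1..s}"
  shows "\<forall>n. H11 (U (Suc n)) (Q (Suc n)) = H11 (U n) (Q n)
           \<and> energy_h xl xr N \<kappa> b \<beta> (U (Suc n)) (Q (Suc n)) = energy_h xl xr N \<kappa> b \<beta> (U n) (Q n)"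
proof
  fix n
  let ?D = "fourier_diff_mat xl xr N 2"
  let ?I = "{1..s}"
  note sympl = assms(7) and grid = assms(3,5)
  note carr = assms(9-14)
  note K = assms(15) and L = assms(16)
  have symD: "transpose_mat ?D = ?D"
    unfolding transpose_fourier_diff_mat[OF grid] by (intro eq_matI) simp_all
  have dims: "dim_vec (U m) = N" "dim_vec (Q m) = N" for m
    using carr by auto
  have D: "?D \<in> carrier_mat N N"
    by (simp add: fourier_diff_mat_def)
  have U_stage: "Us n i $ p = U n $ p + \<tau> * (\<Sum>j\<in>?I. a i j * K n j $ p)"
    if "i \<in> ?I" "p < N" for i p
    unfolding assms(17)[OF that(1), of n] by (rule runge_kutta_update_index) (use that carr in auto)
  have Q_stage: "Qs n i $ p = Q n $ p + \<tau> * (\<Sum>j\<in>?I. a i j * L n j $ p)"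
    if "i \<in> ?I" "p < N" for i p
    unfolding assms(18)[OF that(1), of n] by (rule runge_kutta_update_index) (use that carr in auto)
  have U_next: "U (Suc n) $ p = U n $ p + \<tau> * (\<Sum>i\<in>?I. bw i * K n i $ p)" if "p < N" for p
    unfolding assms(19)[of n] by (rule runge_kutta_update_index) (use that carr in auto)
  have Q_next: "Q (Suc n) $ p = Q n $ p + \<tau> * (\<Sum>i\<in>?I. bw i * L n i $ p)" if "p < N" for p
    unfolding assms(20)[of n] by (rule runge_kutta_update_index) (use that carr in auto)
  have DU_stage: "(?D *\<^sub>v Us n i) $ p = (?D *\<^sub>v U n) $ p + \<tau> * (\<Sum>j\<in>?I. a i j * (?D *\<^sub>v K n j) $ p)"
    if "i \<in> ?I" "p < N" for i p
    unfolding assms(17)[OF that(1), of n] by (rule runge_kutta_update_mat_vec) (use that carr D in auto)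
  have DU_next: "(?D *\<^sub>v U (Suc n)) $ p = (?D *\<^sub>v U n) $ p + \<tau> * (\<Sum>i\<in>?I. bw i * (?D *\<^sub>v K n i) $ p)"
    if "p < N" for p
    unfolding assms(19)[of n] by (rule runge_kutta_update_mat_vec) (use that carr D in auto)
  have L_index: "L n i $ p = 2 * (Us n i $ p * K n i $ p)" if "i \<in> ?I" "p < N" for i p
    using that carr(5)[OF that(1), of n] by (simp add: L cw_prod_def)

  have product_rule: "(u + \<tau> * (\<Sum>i\<in>?I. bw i * k i)) * (q + \<tau> * (\<Sum>i\<in>?I. bw i * l i)) =
      u * q + \<tau> * (\<Sum>i\<in>?I. bw i * (k i * (q + \<tau> * (\<Sum>j\<in>?I. a i j * l j))
                            + l i * (u + \<tau> * (\<Sum>j\<in>?I. a i j * k j))))"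
    for u q :: real and k l
    by (rule symplectic_product_rule) (rule sympl)
  have UU: "U (Suc n) $ p * U (Suc n) $ p = U n $ p * U n $ p
      + \<tau> * (\<Sum>i\<in>?I. bw i * (2 * (Us n i $ p * K n i $ p)))" if p: "p < N" for p
    unfolding U_next[OF p] product_rule
    by (simp add: U_stage[OF _ p] mult.commute cong: sum.cong_simp)
  have H: "H11 (U (Suc n)) (Q (Suc n)) = H11 (U n) (Q n)"
  proof (rule eq_vecI)
    fix p assume "p < dim_vec (H11 (U n) (Q n))"
    then have p: "p < N" by (simp add: H11_def cw_prod_def dims)
    then show "H11 (U (Suc n)) (Q (Suc n)) $ p = H11 (U n) (Q n) $ p"
      by (simp add: H11_def cw_prod_def dims UU Q_next L_index cong: sum.cong_simp)
  qed (simp add: H11_def cw_prod_def dims)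

  have UQ: "U (Suc n) $ p * Q (Suc n) $ p = U n $ p * Q n $ p
      + \<tau> * (\<Sum>i\<in>?I. bw i * (K n i $ p * Qs n i $ p + L n i $ p * Us n i $ p))" if p: "p < N" for p
    unfolding U_next[OF p] Q_next[OF p] product_rule
    by (simp add: U_stage[OF _ p] Q_stage[OF _ p] cong: sum.cong_simp)
  have DUU: "(?D *\<^sub>v U (Suc n)) $ p * U (Suc n) $ p = (?D *\<^sub>v U n) $ p * U n $ p
      + \<tau> * (\<Sum>i\<in>?I. bw i * ((?D *\<^sub>v K n i) $ p * Us n i $ p + K n i $ p * (?D *\<^sub>v Us n i) $ p))"
    if p: "p < N" for p
    unfolding U_next[OF p] DU_next[OF p] product_rule
    by (simp add: U_stage[OF _ p] DU_stage[OF _ p] cong: sum.cong_simp)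

  define g where "g i = \<kappa> \<cdot>\<^sub>v Us n i + b \<cdot>\<^sub>v (?D *\<^sub>v Us n i)
              + (\<beta> / 3) \<cdot>\<^sub>v (Qs n i + 2 \<cdot>\<^sub>v (Us n i \<odot> Us n i))" for i
  \<comment> \<open>The derivative of the energy density at stage \<open>i\<close> along the slopes \<open>(K, L)\<close>.\<close>
  define e' where "e' i p = \<kappa> / 2 * (2 * (Us n i $ p * K n i $ p))
      + b / 2 * ((?D *\<^sub>v K n i) $ p * Us n i $ p + K n i $ p * (?D *\<^sub>v Us n i) $ p)
      + \<beta> / 3 * (K n i $ p * Qs n i $ p + L n i $ p * Us n i $ p)" for i p
  have stage: "(\<Sum>p<N. e' i p) = 0" if i: "i \<in> ?I" for i
  proof -
    note c = carr(3-6)[OF i, of n]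
    have g: "g i \<in> carrier_vec N"
      unfolding g_def using c D by (auto simp: cw_prod_def)
    have g_index: "g i $ p = \<kappa> * Us n i $ p + b * (?D *\<^sub>v Us n i) $ p
        + \<beta> / 3 * (Qs n i $ p + 2 * (Us n i $ p * Us n i $ p))" if p: "p < N" for p
      using p c D by (simp add: g_def cw_prod_def del: index_mult_mat_vec)
    have "(\<Sum>p<N. g i $ p * K n i $ p) = g i \<bullet> K n i"
      using c(1) by (simp add: scalar_prod_def lessThan_atLeast0 carrier_vecD)
    also have "\<dots> = g i \<bullet> (J_mat xl xr N \<delta> \<alpha> *\<^sub>v g i)"
      by (simp only: g_def K[OF i])
    also have "\<dots> = 0"
      by (rule J_mat_skew_form[OF assms(1,2) grid g])
    finally have gK: "(\<Sum>p<N. g i $ p * K n i $ p) = 0" .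
    have "(?D *\<^sub>v K n i) \<bullet> Us n i = K n i \<bullet> (?D *\<^sub>v Us n i)"
      using transpose_vec_mult_scalar[OF D c(3) c(1)] by (simp add: symD)
    then have sym: "(\<Sum>p<N. (?D *\<^sub>v K n i) $ p * Us n i $ p) = (\<Sum>p<N. K n i $ p * (?D *\<^sub>v Us n i) $ p)"
      unfolding scalar_prod_def lessThan_atLeast0
      using carrier_vecD[OF c(3)] carrier_matD(1)[OF D] by (simp del: index_mult_mat_vec)
    \<comment> \<open>The term \<open>2 U\<^sup>2\<close> in \<open>g\<close> accounts for \<open>L = 2 U \<cdot> K\<close>; what remains besides
      \<open>g \<bullet> K\<close> is the defect of symmetry of \<open>D\<^sub>2\<close>, which sums to zero.\<close>
    have "(\<Sum>p<N. e' i p) = (\<Sum>p<N. g i $ p * K n i $ p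
          + b / 2 * ((?D *\<^sub>v K n i) $ p * Us n i $ p - K n i $ p * (?D *\<^sub>v Us n i) $ p))"
      by (intro sum.cong refl) (simp add: e'_def g_index L_index[OF i] field_simps del: index_mult_mat_vec)
    also have "\<dots> = 0"
      unfolding sum.distrib sum_distrib_left[symmetric] sum_subtractf gK sym by simp
    finally show ?thesis .
  qed

  define e where "e u q p = \<kappa> / 2 * (u $ p * u $ p) + b / 2 * ((?D *\<^sub>v u) $ p * u $ p)
      + \<beta> / 3 * (u $ p * q $ p)" for u q p
  have energy: "energy_h xl xr N \<kappa> b \<beta> u q = mesh_width xl xr N * (\<Sum>p<N. e u q p)" for u q
  proof -
    have "mesh_width xl xr N \<ge> 0"
      using grid by (simp add: mesh_width_def)
    then have "inner_h (mesh_width xl xr N) N u u \<ge> 0"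
      by (simp add: inner_h_def sum_nonneg)
    then have "(norm_h (mesh_width xl xr N) N u)\<^sup>2 = inner_h (mesh_width xl xr N) N u u"
      by (simp add: norm_h_def)
    then show ?thesis
      unfolding energy_h_def Let_def e_def sum.distrib sum_distrib_left[symmetric]
      by (simp add: inner_h_def algebra_simps)
  qed
  have "e (U (Suc n)) (Q (Suc n)) p = e (U n) (Q n) p + \<tau> * (\<Sum>i\<in>?I. bw i * e' i p)"
    if p: "p < N" for p
    unfolding e_def e'_def UU[OF p] UQ[OF p] DUU[OF p]
    by (simp only: distrib_left sum.distrib sum_distrib_left ac_simps)
  then have "(\<Sum>p<N. e (U (Suc n)) (Q (Suc n)) p)
      = (\<Sum>p<N. e (U n) (Q n) p) + \<tau> * (\<Sum>p<N. \<Sum>i\<in>?I. bw i * e' i p)"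
    by (simp add: sum.distrib sum_distrib_left)
  also have "(\<Sum>p<N. \<Sum>i\<in>?I. bw i * e' i p) = (\<Sum>i\<in>?I. bw i * (\<Sum>p<N. e' i p))"
    unfolding sum_distrib_left by (rule sum.swap)
  also have "\<dots> = 0"
    by (simp add: stage)
  finally have "energy_h xl xr N \<kappa> b \<beta> (U (Suc n)) (Q (Suc n)) = energy_h xl xr N \<kappa> b \<beta> (U n) (Q n)"
    by (simp add: energy)
  with H show "H11 (U (Suc n)) (Q (Suc n)) = H11 (U n) (Q n)
           \<and> energy_h xl xr N \<kappa> b \<beta> (U (Suc n)) (Q (Suc n)) = energy_h xl xr N \<kappa> b \<beta> (U n) (Q n)" ..
qed

end
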